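(* There is an absolute constant $C>0$ such that for every integer $n\geqslant 2$ and all $p_1,\dots,p_n\in[0,1]$, not satisfying $p_1=\cdots=p_n\in\{0,1\}$, for which $\delta<1$, one has \[ \frac{n}{2(n-1)}\,\delta^2\leqslant \chi^2(\mathscr{L}(S_n),\mathscr{B}(n,p))\leqslant \frac{n}{2(n-1)}\,\delta^2\left(1+C\left(\frac{\delta}{1-\delta}+\frac{1}{\sqrt{n}}\,\frac{\delta_3}{\delta}\right)\right). \]
   Context: Let $S_n=I_1+\cdots+I_n$ be a sum of independent indicator random variables with $\mathbb{P}(I_j=1)=p_j$ and $\mathbb{P}(I_j=0)=1-p_j$, where $p_j\in[0,1]$; $\mathscr{L}(S_n)$ is its law. Put $p=\frac1n\sum_{j=1}^n p_j$ and $q=1-p$. It is assumed throughout that it is not the case that $p_1=\cdots=p_n\in\{0,1\}$, so that $0<p<1$ and $0<q<1$. $\mathscr{B}(n,p)$ is the binomial distribution with weights $b(n,p,j)=\binom nj p^jq^{n-j}$, $0\leqslant j\leqslant n$. For $m>0$ define \[ \delta_m=\frac{1}{n(pq)^{m/2}}\sum_{j=1}^n|p_j-p|^m,\qquad \delta:=\delta_2 . \] The $\chi^2$-distance is \[ \chi^2(\mathscr{L}(S_n),\mathscr{B}(n,p))=\sum_{j=0}^n\left|\frac{\mathbb{P}(S_n=j)}{b(n,p,j)}-1\right|^2 b(n,p,j). \] Convention: if $\delta=0$ (all $p_j$ equal), the ratio $\delta_3/\delta$ is read as $0$. *)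

theory Defs
  imports "HOL-Probability.Probability"
begin

definition mean_p :: "nat \<Rightarrow> (nat \<Rightarrow> real) \<Rightarrow> real" where
  "mean_p n p = (1 / real n) * (\<Sum>j=1..n. p j)"

text \<open>
  The law of \<open>S\<^sub>n = I\<^sub>1 + \<dots> + I\<^sub>n\<close>, realised on the product of Bernoulli distributions. A
  concrete realisation is used because a constant that is existentially quantified before a
  measure over a type variable would be allowed to depend on that type. The lemma
  \<open>prob_sum_indicators\<close> below shows that independent indicators on an arbitrary probability
  space give the same law.
\<close>

definition indicator_sum_law :: "nat \<Rightarrow> (nat \<Rightarrow> real) \<Rightarrow> nat pmf" where
  "indicator_sum_law n p =
     map_pmf (\<lambda>I. \<Sum>j=1..n. of_bool (I j)) (Pi_pmf {1..n} False (\<lambda>j. bernoulli_pmf (p j)))"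

definition delta_m :: "nat \<Rightarrow> (nat \<Rightarrow> real) \<Rightarrow> real \<Rightarrow> real" where
  "delta_m n p m =
     (let pb = mean_p n p; qb = 1 - pb
      in 1 / (real n * (pb * qb) powr (m / 2)) * (\<Sum>j=1..n. \<bar>p j - pb\<bar> powr m))"

definition chi2_dist :: "nat \<Rightarrow> nat pmf \<Rightarrow> nat pmf \<Rightarrow> real" where
  "chi2_dist n P Q = (\<Sum>j=0..n. \<bar>pmf P j / pmf Q j - 1\<bar> ^ 2 * pmf Q j)"

lemma (in prob_space) prob_sum_indicators:
  fixes I :: "nat \<Rightarrow> 'a \<Rightarrow> nat" and p :: "nat \<Rightarrow> real"
  assumes indep: "indep_vars (\<lambda>_. count_space UNIV) I {1..n}"
    and p01: "\<And>j. j \<in> {1..n} \<Longrightarrow> p j \<in> {0..1}"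
    and one: "\<And>j. j \<in> {1..n} \<Longrightarrow> prob {\<omega> \<in> space M. I j \<omega> = 1} = p j"
    and zero: "\<And>j. j \<in> {1..n} \<Longrightarrow> prob {\<omega> \<in> space M. I j \<omega> = 0} = 1 - p j"
  shows "prob {\<omega> \<in> space M. (\<Sum>j=1..n. I j \<omega>) = k} = pmf (indicator_sum_law n p) k"
proof -
  define A where "A = {1..n}"
  define D where "D = Pi_pmf A False (\<lambda>j. bernoulli_pmf (p j))"
  define f :: "(nat \<Rightarrow> bool) \<Rightarrow> nat" where "f = (\<lambda>x. \<Sum>j\<in>A. of_bool (x j))"
  define Y where "Y = (\<lambda>\<omega> j. j \<in> A \<and> I j \<omega> = 1)"
  define F where "F = {x :: nat \<Rightarrow> bool. \<forall>j. j \<notin> A \<longrightarrow> x j = False}"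
  have finA: "finite A" by (simp add: A_def)
  have one': "prob {\<omega> \<in> space M. I j \<omega> = Suc 0} = p j"
    and zero': "prob {\<omega> \<in> space M. I j \<omega> = 0} = 1 - p j"
    and p01': "0 \<le> p j" "p j \<le> 1" if "j \<in> A" for j
    using one[of j] zero[of j] p01[of j] that by (simp_all add: A_def)
  have finF: "finite F"
  proof (rule finite_subset)
    show "F \<subseteq> (\<lambda>S j. j \<in> S) ` Pow A"
    proof
      fix x assume "x \<in> F"
      then have "{j. x j} \<in> Pow A" "x = (\<lambda>j. j \<in> {j. x j})" by (auto simp: F_def)
      then show "x \<in> (\<lambda>S j. j \<in> S) ` Pow A" by blast
    qed
  qed (use finA in simp)
  have meas[measurable]: "I j \<in> measurable M (count_space UNIV)" if "j \<in> A" for j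
    using indep that by (auto simp: indep_vars_def A_def)
  have measX: "{\<omega> \<in> space M. P (I j \<omega>)} \<in> events" if "j \<in> A" for j and P :: "nat \<Rightarrow> bool"
    using measurable_sets[OF meas[OF that], of "{x. P x}"] by (simp add: vimage_def Int_def conj_commute)
  have AE01: "AE \<omega> in M. \<forall>j\<in>A. I j \<omega> = 0 \<or> I j \<omega> = 1"
  proof (rule AE_finite_allI[OF finA])
    fix j assume j: "j \<in> A"
    have "prob ({\<omega> \<in> space M. I j \<omega> = 0} \<union> {\<omega> \<in> space M. I j \<omega> = 1}) = 1"
      using j by (subst finite_measure_Union) (auto simp: measX one' zero')
    also have "{\<omega> \<in> space M. I j \<omega> = 0} \<union> {\<omega> \<in> space M. I j \<omega> = 1}
        = {\<omega> \<in> space M. I j \<omega> = 0 \<or> I j \<omega> = 1}" by auto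
    finally show "AE \<omega> in M. I j \<omega> = 0 \<or> I j \<omega> = 1"
      using prob_Collect_eq_1[OF measX[OF j, of "\<lambda>v. v = 0 \<or> v = 1"]] by simp
  qed
  have nz: "prob {\<omega> \<in> space M. I j \<omega> \<noteq> 1} = 1 - p j" if j: "j \<in> A" for j
  proof -
    have "{\<omega> \<in> space M. I j \<omega> \<noteq> 1} = space M - {\<omega> \<in> space M. I j \<omega> = 1}" by auto
    then show ?thesis using prob_compl[OF measX[OF j, of "\<lambda>x. x = 1"]] one' j by simp
  qed
  have Ymeas: "{\<omega> \<in> space M. Y \<omega> = x} \<in> events" if "x \<in> F" for x
  proof -
    have "{\<omega> \<in> space M. Y \<omega> = x} = {\<omega> \<in> space M. \<forall>j\<in>A. (I j \<omega> = 1) = x j}"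
      using that by (auto simp: Y_def F_def fun_eq_iff)
    also have "\<dots> \<in> events"
      using finA by (intro sets.sets_Collect_finite_All measX)
    finally show ?thesis .
  qed
  have Yprob: "prob {\<omega> \<in> space M. Y \<omega> = x} = pmf D x" if x: "x \<in> F" for x
  proof (cases "A = {}")
    case True
    then have "{\<omega> \<in> space M. Y \<omega> = x} = space M" using x by (auto simp: Y_def F_def fun_eq_iff)
    then show ?thesis using True x by (auto simp: D_def F_def prob_space fun_eq_iff indicator_def)
  next
    case False
    have "{\<omega> \<in> space M. Y \<omega> = x} = (\<Inter>j\<in>A. I j -` {v. (v = 1) = x j} \<inter> space M)"
      using x False by (auto simp: Y_def F_def fun_eq_iff)
    then have "prob {\<omega> \<in> space M. Y \<omega> = x} = (\<Prod>j\<in>A. prob (I j -` {v. (v = 1) = x j} \<inter> space M))"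
      using indep_varsD_finite[OF indep[folded A_def] False finA, of "\<lambda>j. {v. (v = 1) = x j}"]
      by (simp only: sets_count_space Pow_UNIV UNIV_I simp_thms)
    also have "\<dots> = (\<Prod>j\<in>A. pmf (bernoulli_pmf (p j)) (x j))"
    proof (rule prod.cong[OF refl])
      fix j assume j: "j \<in> A"
      have "I j -` {v. (v = 1) = x j} \<inter> space M = {\<omega> \<in> space M. (I j \<omega> = 1) = x j}" by auto
      then show "prob (I j -` {v. (v = 1) = x j} \<inter> space M) = pmf (bernoulli_pmf (p j)) (x j)"
        using nz[OF j] one'[OF j] p01'[OF j] by (cases "x j") auto
    qed
    also have "\<dots> = pmf D x"
      using x finA by (subst D_def, subst pmf_Pi') (auto simp: F_def)
    finally show ?thesis .
  qed
  have Un: "{\<omega> \<in> space M. f (Y \<omega>) = k} = (\<Union>x\<in>{x\<in>F. f x = k}. {\<omega> \<in> space M. Y \<omega> = x})"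
    by (auto simp: Y_def F_def)
  have fY: "{\<omega> \<in> space M. f (Y \<omega>) = k} \<in> events"
    unfolding Un using finF Ymeas by (intro sets.finite_UN) auto
  have Smeas: "{\<omega> \<in> space M. (\<Sum>j\<in>A. I j \<omega>) = k} \<in> events"
  proof -
    have "(\<lambda>\<omega>. \<Sum>j\<in>A. I j \<omega>) \<in> measurable M (count_space UNIV)"
      using finA meas by (intro measurable_sum_nat) auto
    from measurable_sets[OF this, of "{k}"] show ?thesis
      by (simp add: vimage_def Int_def conj_commute)
  qed
  have "prob {\<omega> \<in> space M. (\<Sum>j=1..n. I j \<omega>) = k} = prob {\<omega> \<in> space M. f (Y \<omega>) = k}"
  proof (rule finite_measure_eq_AE)
    show "AE \<omega> in M. \<omega> \<in> {\<omega> \<in> space M. (\<Sum>j=1..n. I j \<omega>) = k} \<longleftrightarrow>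
        \<omega> \<in> {\<omega> \<in> space M. f (Y \<omega>) = k}"
      using AE01
    proof eventually_elim
      case (elim \<omega>)
      have "f (Y \<omega>) = (\<Sum>j\<in>A. I j \<omega>)"
        unfolding f_def using elim by (intro sum.cong) (auto simp: Y_def)
      then show ?case by (simp add: A_def)
    qed
  qed (use fY Smeas in \<open>simp_all add: A_def\<close>)
  also have "\<dots> = (\<Sum>x\<in>{x\<in>F. f x = k}. prob {\<omega> \<in> space M. Y \<omega> = x})"
    unfolding Un using finF Ymeas
    by (intro finite_measure_finite_Union) (auto simp: disjoint_family_on_def)
  also have "\<dots> = (\<Sum>x\<in>{x\<in>F. f x = k}. pmf D x)" using Yprob by simp
  also have "\<dots> = measure_pmf.prob D {x\<in>F. f x = k}"
    using finF by (simp add: measure_measure_pmf_finite)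
  also have "\<dots> = measure_pmf.prob D (f -` {k})"
    using set_Pi_pmf_subset[OF finA, of False "\<lambda>j. bernoulli_pmf (p j)"]
    by (intro measure_pmf.finite_measure_eq_AE) (auto simp: AE_measure_pmf_iff D_def F_def)
  also have "\<dots> = pmf (indicator_sum_law n p) k"
    by (simp add: indicator_sum_law_def pmf_map D_def f_def A_def)
  finally show ?thesis .
qed

end

theory Submission
  imports Defs
begin

text \<open>
  Write \<open>x\<^sub>j = (p\<^sub>j - p) / sqrt (p q)\<close>, so that \<open>\<Sum> x\<^sub>j = 0\<close> and \<open>\<Sum> x\<^sub>j\<^sup>2 = n \<delta>\<close>, and let \<open>e\<^sub>k\<close> be the
  \<open>k\<close>-th elementary symmetric function of the \<open>x\<^sub>j\<close>. The proof rests on the exact expansion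
  \<open>1 + \<chi>\<^sup>2 = \<Sum>k\<le>n. e\<^sub>k\<^sup>2 / (n choose k)\<close> (\<open>chi2_dist_eq_sum_elementary_symmetric\<close>). Here
  \<open>e\<^sub>0 = 1\<close> and \<open>e\<^sub>1 = 0\<close>, while \<open>e\<^sub>2 = - n \<delta> / 2\<close> makes the term \<open>k = 2\<close> equal to
  \<open>n / (2 (n - 1)) \<delta>\<^sup>2\<close>. All terms are nonnegative, which gives the lower bound; the upper bound
  amounts to an estimate of the tail \<open>k \<ge> 3\<close>.

  The expansion could be read off from orthogonality of the Krawtchouk polynomials. The route
  taken here uses that, for \<open>\<Prod>j. a\<^sub>j + b\<^sub>j w = \<Sum>k. E\<^sub>k w\<^sup>k\<close>, the quantity
  \<open>\<Sum>k. E\<^sub>k\<^sup>2 / (n choose k)\<close> (the squared Bombieri norm) equals the permanent of the Gram matrix of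
  the vectors \<open>(a\<^sub>j, b\<^sub>j)\<close> divided by \<open>n!\<close> (\<open>sum_linear_prod_coeff_squares_eq_permanent\<close>). The vectors
  \<open>((1 - p\<^sub>j) / sqrt q, p\<^sub>j / sqrt p)\<close>, which produce \<open>1 + \<chi>\<^sup>2\<close>, and the vectors \<open>(1, x\<^sub>j)\<close>, which
  produce the \<open>e\<^sub>k\<close>, have the same Gram matrix \<open>1 + x\<^sub>i x\<^sub>j\<close>.

  For the tail, Parseval's identity for \<open>\<Prod>j. a\<^sub>j + b\<^sub>j w\<close> on the unit circle and the inequality of
  arithmetic and geometric means, applied at each point of the circle to the factors
  \<open>\<bar>a\<^sub>j + b\<^sub>j w\<bar>\<^sup>2\<close>, bound \<open>\<Sum>k. E\<^sub>k\<^sup>2\<close>. Taking \<open>a\<^sub>j = sqrt (1 - t)\<close> and \<open>b\<^sub>j = sqrt (s t) x\<^sub>j\<close> and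
  integrating over \<open>t \<in> [0, 1]\<close> turns this, through the Beta integral, into
  \<open>(\<Sum>k\<le>n. e\<^sub>k\<^sup>2 / (n choose k) * s\<^sup>k) \<le> (\<Sum>k\<le>n. (s \<delta>)\<^sup>k)\<close>
  (\<open>sum_elementary_symmetric_squares_le\<close>). If \<open>\<delta> > 0\<close>, the right-hand side stays below \<open>2 / (1 - \<delta>)\<close> for
  \<open>s = (1 + \<delta>) / (2 \<delta>)\<close>, and each term with \<open>k \<ge> 3\<close> carries a factor at least
  \<open>s\<^sup>3 \<ge> 1 / (2 \<delta>)\<^sup>3\<close>, so the tail at \<open>s = 1\<close> is at most \<open>16 \<delta>\<^sup>3 / (1 - \<delta>)\<close>
  (\<open>sum_elementary_symmetric_squares_tail_le\<close>). This is at most the term \<open>k = 2\<close> times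
  \<open>32 \<delta> / (1 - \<delta>)\<close>.
\<close>

section \<open>Coefficients of a product of linear factors\<close>

text \<open>
  The coefficient of \<open>w ^ k\<close> in \<open>\<Prod>j\<in>S. a j + b j * w\<close>. It is the \<open>k\<close>-th elementary symmetric function
  of \<open>b\<close> when \<open>a = 1\<close>, and the probability of \<open>k\<close> successes when \<open>b = p\<close> and \<open>a = 1 - p\<close>. A
  general \<open>a\<close> makes it possible to exchange the vectors \<open>(a j, b j)\<close> for others with the same inner
  products.
\<close>
definition linear_prod_coeff :: "('a \<Rightarrow> 'b::comm_ring_1) \<Rightarrow> ('a \<Rightarrow> 'b) \<Rightarrow> 'a set \<Rightarrow> nat \<Rightarrow> 'b" where
  "linear_prod_coeff a b S k = (\<Sum>A | A \<subseteq> S \<and> card A = k. (\<Prod>j\<in>A. b j) * (\<Prod>j\<in>S - A. a j))"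

lemma sum_Pow_by_card:
  fixes f :: "'a set \<Rightarrow> 'b::comm_monoid_add"
  assumes "finite S"
  shows "(\<Sum>A\<in>Pow S. f A) = (\<Sum>k\<le>card S. \<Sum>A | A \<subseteq> S \<and> card A = k. f A)"
proof -
  have "(\<Sum>A\<in>Pow S. f A) = (\<Sum>k\<le>card S. \<Sum>A\<in>{A\<in>Pow S. card A = k}. f A)"
    using assms by (intro sum.group[symmetric]) (auto intro: card_mono)
  then show ?thesis by simp
qed

lemma linear_prod_eq_sum_coeff:
  assumes "finite S"
  shows "(\<Prod>j\<in>S. a j + b j * w) = (\<Sum>k\<le>card S. linear_prod_coeff a b S k * w ^ k)"
proof -
  have "(\<Prod>j\<in>S. a j + b j * w) = (\<Prod>j\<in>S. b j * w + a j)"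
    by (simp add: add.commute)
  also have "\<dots> = (\<Sum>A\<in>Pow S. (\<Prod>j\<in>A. b j * w) * (\<Prod>j\<in>S - A. a j))"
    using assms by (rule prod_add)
  also have "\<dots> = (\<Sum>k\<le>card S. linear_prod_coeff a b S k * w ^ k)"
    unfolding sum_Pow_by_card[OF assms] linear_prod_coeff_def sum_distrib_right
    by (intro sum.cong refl) (auto simp: prod.distrib mult_ac)
  finally show ?thesis .
qed

lemma linear_prod_coeff_scale:
  assumes "finite S"
  shows "linear_prod_coeff (\<lambda>j. c * a j) (\<lambda>j. d * b j) S k
    = c ^ (card S - k) * d ^ k * linear_prod_coeff a b S k"
  unfolding linear_prod_coeff_def sum_distrib_left
  using assms by (intro sum.cong refl) (auto simp: prod.distrib card_Diff_subset finite_subset mult_ac)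

lemma linear_prod_coeff_0:
  assumes "finite S"
  shows "linear_prod_coeff a b S 0 = (\<Prod>j\<in>S. a j)"
proof -
  have "{A. A \<subseteq> S \<and> card A = 0} = {{}}"
    using assms by (auto dest: finite_subset)
  then show ?thesis by (simp add: linear_prod_coeff_def)
qed

text \<open>Multiplication by the factor \<open>a s + b s * w\<close>, coefficient by coefficient.\<close>
lemma linear_prod_coeff_insert:
  assumes "finite S" "s \<notin> S"
  shows "linear_prod_coeff a b (insert s S) (Suc k)
    = a s * linear_prod_coeff a b S (Suc k) + b s * linear_prod_coeff a b S k"
proof -
  let ?m = "\<lambda>T A. (\<Prod>j\<in>A. b j) * (\<Prod>j\<in>T - A. a j)"
  let ?F = "\<lambda>k. {A. A \<subseteq> S \<and> card A = k}"
  have fin: "finite (?F i)" for i using assms by simp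
  have split: "{A. A \<subseteq> insert s S \<and> card A = Suc k} = ?F (Suc k) \<union> insert s ` ?F k" (is "?L = ?R")
  proof (intro equalityI subsetI)
    fix A assume A: "A \<in> ?L"
    show "A \<in> ?R"
    proof (cases "s \<in> A")
      case True
      have "A = insert s (A - {s})" "A - {s} \<subseteq> S" "card (A - {s}) = k"
        using A True assms by (auto simp: card_Diff_singleton)
      then show ?thesis by blast
    qed (use A in auto)
  next
    fix A assume "A \<in> ?R"
    then show "A \<in> ?L"
      using assms finite_subset[of _ S] by (auto simp: card_insert_if)
  qed
  have "linear_prod_coeff a b (insert s S) (Suc k)
      = (\<Sum>A\<in>?F (Suc k). ?m (insert s S) A) + (\<Sum>A\<in>insert s ` ?F k. ?m (insert s S) A)"
    unfolding linear_prod_coeff_def split using fin assms by (intro sum.union_disjoint) auto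
  also have "(\<Sum>A\<in>insert s ` ?F k. ?m (insert s S) A) = (\<Sum>A\<in>?F k. ?m (insert s S) (insert s A))"
    using assms by (subst sum.reindex) (auto simp: inj_on_def insert_ident)
  also have "\<dots> = b s * linear_prod_coeff a b S k"
    unfolding linear_prod_coeff_def sum_distrib_left
  proof (intro sum.cong refl)
    fix A assume A: "A \<in> ?F k"
    then have "insert s S - insert s A = S - A" "finite A" "s \<notin> A"
      using assms by (auto dest: finite_subset)
    then show "?m (insert s S) (insert s A) = b s * ?m S A" by (simp add: mult_ac)
  qed
  also have "(\<Sum>A\<in>?F (Suc k). ?m (insert s S) A) = a s * linear_prod_coeff a b S (Suc k)"
    unfolding linear_prod_coeff_def sum_distrib_left
  proof (intro sum.cong refl)
    fix A assume A: "A \<in> ?F (Suc k)"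
    then have "insert s S - A = insert s (S - A)"
      using assms by auto
    then show "?m (insert s S) A = a s * ?m S A" using assms by (simp add: mult_ac)
  qed
  finally show ?thesis .
qed

lemma linear_prod_coeff_1:
  assumes "finite S"
  shows "linear_prod_coeff (\<lambda>_. 1) x S 1 = (\<Sum>j\<in>S. x j)"
  using assms
proof (induction S)
  case empty
  have "linear_prod_coeff (\<lambda>_. 1) x {} 1 = 0" unfolding linear_prod_coeff_def by (intro sum.neutral) auto
  then show ?case by simp
next
  case (insert s S)
  then show ?case
    using linear_prod_coeff_insert[of S s "\<lambda>_. 1" x 0] by (simp add: linear_prod_coeff_0 add.commute)
qed

lemma linear_prod_coeff_2:
  assumes "finite S"
  shows "2 * linear_prod_coeff (\<lambda>_. 1) x S 2 = (\<Sum>j\<in>S. x j)\<^sup>2 - (\<Sum>j\<in>S. (x j)\<^sup>2)"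
  using assms
proof (induction S)
  case empty
  have "linear_prod_coeff (\<lambda>_. 1) x {} 2 = 0" unfolding linear_prod_coeff_def by (intro sum.neutral) auto
  then show ?case by simp
next
  case (insert s S)
  have "linear_prod_coeff (\<lambda>_. 1) x (insert s S) 2
      = linear_prod_coeff (\<lambda>_. 1) x S 2 + x s * (\<Sum>j\<in>S. x j)"
    using linear_prod_coeff_insert[of S s "\<lambda>_. 1" x 1] insert linear_prod_coeff_1[of S x]
    by (simp add: numeral_2_eq_2)
  then show ?case
    using insert by (simp add: algebra_simps power2_eq_square)
qed

section \<open>The permanent identity\<close>

lemma permutes_image_onto:
  assumes "finite S" "A \<subseteq> S" "B \<subseteq> S" "card A = card B"
  obtains \<sigma> where "\<sigma> permutes S" "\<sigma> ` A = B"
proof -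
  have fin: "finite A" "finite B" using assms by (auto dest: finite_subset)
  obtain g where g: "bij_betw g A B"
    using finite_same_card_bij[OF fin assms(4)] by blast
  have "card (S - A) = card (S - B)"
    using assms fin by (simp add: card_Diff_subset)
  then obtain h where h: "bij_betw h (S - A) (S - B)"
    using finite_same_card_bij[of "S - A" "S - B"] assms by auto
  define f where "f = (\<lambda>j. if j \<in> A then g j else h j)"
  have fA: "bij_betw f A B" using g by (rule bij_betw_cong[THEN iffD1, rotated]) (simp add: f_def)
  have fB: "bij_betw f (S - A) (S - B)" using h by (rule bij_betw_cong[THEN iffD1, rotated]) (simp add: f_def)
  have "bij_betw f (A \<union> (S - A)) (B \<union> (S - B))"
    using fA fB by (rule bij_betw_combine) auto
  then have "bij_betw f S S" using assms by (simp add: Un_absorb1)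
  then have "restrict_id f S permutes S" by (rule permutes_restrict_id)
  moreover have "restrict_id f S ` A = B"
    using fA assms(2) by (auto simp: bij_betw_def restrict_id_def image_iff subset_iff)
  ultimately show ?thesis by (rule that)
qed

text \<open>
  The image of a fixed set under a uniformly random permutation is uniform among the sets of the
  same size. The left-hand side depends on \<open>A\<close> only through \<open>card A\<close>, because composing \<open>\<pi>\<close> with a
  permutation moving \<open>A\<close> to \<open>B\<close> permutes the summands; so it may be averaged over all sets of that
  size, and each \<open>\<pi>\<close> permutes those sets.
\<close>
lemma sum_permutes_image:
  fixes m :: "'a set \<Rightarrow> real"
  assumes S: "finite S" and A: "A \<subseteq> S"
  shows "(\<Sum>\<pi> | \<pi> permutes S. m (\<pi> ` A))
    = fact (card S) / real (card S choose card A) * (\<Sum>B | B \<subseteq> S \<and> card B = card A. m B)"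
proof -
  let ?F = "{B. B \<subseteq> S \<and> card B = card A}"
  let ?T = "\<lambda>B. \<Sum>\<pi> | \<pi> permutes S. m (\<pi> ` B)"
  have const: "?T B = ?T A" if B: "B \<in> ?F" for B
  proof -
    obtain \<sigma> where \<sigma>: "\<sigma> permutes S" "\<sigma> ` A = B"
      using permutes_image_onto[of S A B] S A B by auto
    show ?thesis
      using sum_permutations_compose_right[OF \<sigma>(1), of "\<lambda>\<pi>. m (\<pi> ` A)"] \<sigma>(2)
      by (simp add: image_image flip: \<sigma>(2))
  qed
  have cardF: "card ?F = card S choose card A" using n_subsets[OF S] .
  have pos: "card S choose card A > 0" using card_mono[OF S A] by simp
  have "real (card ?F) * ?T A = (\<Sum>B\<in>?F. ?T B)"
    using const by simp
  also have "\<dots> = (\<Sum>\<pi> | \<pi> permutes S. \<Sum>B\<in>?F. m (\<pi> ` B))"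
    by (rule sum.swap)
  also have "\<dots> = (\<Sum>\<pi> | \<pi> permutes S. \<Sum>B\<in>?F. m B)"
  proof (rule sum.cong[OF refl])
    fix \<pi> assume "\<pi> \<in> {\<pi>. \<pi> permutes S}"
    then have \<pi>: "\<pi> permutes S" by simp
    have "bij_betw ((`) \<pi>) ?F ?F"
    proof (rule bij_betwI[where g = "(`) (inv \<pi>)"])
      have *: "\<tau> ` B \<in> ?F" if "\<tau> permutes S" "B \<in> ?F" for \<tau> B
        using that permutes_image[OF that(1)] permutes_inj_on[OF that(1), of B]
        by (auto simp: card_image)
      show "(`) \<pi> \<in> ?F \<rightarrow> ?F" "(`) (inv \<pi>) \<in> ?F \<rightarrow> ?F"
        using *[OF \<pi>] *[OF permutes_inv[OF \<pi>]] by blast+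
      show "inv \<pi> ` \<pi> ` B = B" "\<pi> ` inv \<pi> ` B = B" for B
        using permutes_inverses[OF \<pi>] by (simp_all add: image_comp comp_def)
    qed
    then show "(\<Sum>B\<in>?F. m (\<pi> ` B)) = (\<Sum>B\<in>?F. m B)"
      using sum.reindex_bij_betw[of "(`) \<pi>" ?F ?F m] by simp
  qed
  also have "\<dots> = fact (card S) * (\<Sum>B\<in>?F. m B)"
    using card_permutations[OF refl S] by simp
  finally show ?thesis
    using pos unfolding cardF by (simp add: field_simps)
qed

text \<open>
  The right-hand side is the permanent of the Gram matrix of the vectors \<open>(a j, b j)\<close>, divided by
  \<open>n!\<close>, i.e. the mean over \<open>\<pi>\<close> of the product. Expanding the product over the subsets \<open>A\<close> from which
  the \<open>b\<close>-terms are taken gives \<open>m A * m (\<pi> ` A)\<close>, where \<open>m A\<close> is the contribution of \<open>A\<close> to the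
  coefficient of index \<open>card A\<close>. By uniformity of \<open>\<pi> ` A\<close> the mean of \<open>m (\<pi> ` A)\<close> is that coefficient
  divided by the binomial coefficient, and summing \<open>m A\<close> over \<open>A\<close> supplies the second factor. The point
  of the identity is that its left-hand side depends on the inner products of the vectors alone.
\<close>
theorem sum_linear_prod_coeff_squares_eq_permanent:
  fixes a b :: "'a \<Rightarrow> real"
  assumes S: "finite S"
  shows "(\<Sum>k\<le>card S. (linear_prod_coeff a b S k)\<^sup>2 / real (card S choose k))
    = (\<Sum>\<pi> | \<pi> permutes S. \<Prod>j\<in>S. a j * a (\<pi> j) + b j * b (\<pi> j)) / fact (card S)"
proof -
  define m where "m = (\<lambda>A. (\<Prod>j\<in>A. b j) * (\<Prod>j\<in>S - A. a j))"
  let ?n = "card S"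
  have expand: "(\<Prod>j\<in>S. a j * a (\<pi> j) + b j * b (\<pi> j)) = (\<Sum>A\<in>Pow S. m A * m (\<pi> ` A))"
    if \<pi>: "\<pi> permutes S" for \<pi>
  proof -
    have "(\<Prod>j\<in>S. a j * a (\<pi> j) + b j * b (\<pi> j))
        = (\<Sum>A\<in>Pow S. (\<Prod>j\<in>A. b j * b (\<pi> j)) * (\<Prod>j\<in>S - A. a j * a (\<pi> j)))"
      using prod_add[OF S, of "\<lambda>j. b j * b (\<pi> j)" "\<lambda>j. a j * a (\<pi> j)"] by (simp add: add.commute)
    also have "\<dots> = (\<Sum>A\<in>Pow S. m A * m (\<pi> ` A))"
    proof (intro sum.cong refl)
      fix A assume "A \<in> Pow S"
      have "S - \<pi> ` A = \<pi> ` (S - A)"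
        using permutes_image[OF \<pi>] image_set_diff[OF permutes_inj[OF \<pi>], of S A] by simp
      then have "m (\<pi> ` A) = (\<Prod>j\<in>A. b (\<pi> j)) * (\<Prod>j\<in>S - A. a (\<pi> j))"
        unfolding m_def
        by (simp add: prod.reindex[OF permutes_inj_on[OF \<pi>]] comp_def)
      then show "(\<Prod>j\<in>A. b j * b (\<pi> j)) * (\<Prod>j\<in>S - A. a j * a (\<pi> j)) = m A * m (\<pi> ` A)"
        by (simp add: m_def prod.distrib mult_ac)
    qed
    finally show ?thesis .
  qed
  have pc: "linear_prod_coeff a b S k = (\<Sum>B | B \<subseteq> S \<and> card B = k. m B)" for k
    by (simp add: linear_prod_coeff_def m_def)
  have "(\<Sum>\<pi> | \<pi> permutes S. \<Prod>j\<in>S. a j * a (\<pi> j) + b j * b (\<pi> j))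
      = (\<Sum>\<pi> | \<pi> permutes S. \<Sum>A\<in>Pow S. m A * m (\<pi> ` A))"
    using expand by simp
  also have "\<dots> = (\<Sum>A\<in>Pow S. m A * (\<Sum>\<pi> | \<pi> permutes S. m (\<pi> ` A)))"
    by (subst sum.swap) (simp add: sum_distrib_left)
  also have "\<dots> = (\<Sum>A\<in>Pow S. m A * (fact ?n / real (?n choose card A) * linear_prod_coeff a b S (card A)))"
    by (intro sum.cong refl) (simp add: sum_permutes_image[OF S] pc)
  also have "\<dots> = (\<Sum>k\<le>?n. \<Sum>A | A \<subseteq> S \<and> card A = k.
                   m A * (fact ?n / real (?n choose k) * linear_prod_coeff a b S k))"
    unfolding sum_Pow_by_card[OF S] by (intro sum.cong refl) auto
  also have "\<dots> = (\<Sum>k\<le>?n. linear_prod_coeff a b S k * (fact ?n / real (?n choose k) * linear_prod_coeff a b S k))"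
    by (simp only: pc[symmetric] sum_distrib_right[symmetric])
  also have "\<dots> = fact ?n * (\<Sum>k\<le>?n. (linear_prod_coeff a b S k)\<^sup>2 / real (?n choose k))"
    by (simp add: sum_distrib_left power2_eq_square mult_ac)
  finally show ?thesis by simp
qed

section \<open>A mean square bound on the unit circle\<close>

lemma sum_cis_multiples_eq_0:
  assumes "k < N" "l < N" "k \<noteq> l"
  shows "(\<Sum>m<N. cis (2 * pi * real m * (real k - real l) / real N)) = 0"
proof -
  define z where "z = cis (2 * pi * (real k - real l) / real N)"
  have pow: "cis (2 * pi * real m * (real k - real l) / real N) = z ^ m" for m
    by (simp add: z_def Complex.DeMoivre algebra_simps)
  have zN: "z ^ N = 1"
  proof -
    have "z ^ N = cis (2 * pi * (of_int (int k - int l)))"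
      using assms by (simp add: z_def Complex.DeMoivre)
    also have "\<dots> = 1" by (rule cis_multiple_2pi) simp
    finally show ?thesis .
  qed
  have "z \<noteq> 1"
  proof
    assume "z = 1"
    then have "cos (2 * pi * (real k - real l) / real N) = 1"
      by (simp add: z_def complex_eq_iff)
    then obtain i :: int where "2 * pi * (real k - real l) / real N = of_int i * 2 * pi"
      using cos_one_2pi_int by blast
    then have "real k - real l = of_int i * real N"
    proof -
      have "(2 * pi) * (real k - real l) = (2 * pi) * (of_int i * real N)"
        using assms \<open>2 * pi * (real k - real l) / real N = of_int i * 2 * pi\<close>
        by (simp add: field_simps)
      then show ?thesis by simp
    qed
    then have "of_int (int k - int l) = (of_int (i * int N) :: real)" by simp
    then have "int k - int l = i * int N" by (simp only: of_int_eq_iff)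
    moreover have "i \<noteq> 0" using calculation assms by auto
    then have "int N \<le> \<bar>i * int N\<bar>" using assms by (simp add: abs_mult mult_le_cancel_right1)
    ultimately show False using assms by linarith
  qed
  then show ?thesis
    using zN geometric_sum[of z N] by (simp add: pow)
qed

text \<open>
  For a polynomial of degree below \<open>N\<close>, the mean of \<open>\<bar>P\<bar>\<^sup>2\<close> over the \<open>N\<close>-th roots of unity agrees with
  its mean over the circle; the finite sum replaces an integral over the angle.
\<close>
lemma Parseval_roots_of_unity:
  fixes c :: "nat \<Rightarrow> real"
  assumes "n < N"
  shows "(\<Sum>m<N. (cmod (\<Sum>k\<le>n. of_real (c k) * cis (2 * pi * real m / real N) ^ k))\<^sup>2)
    = real N * (\<Sum>k\<le>n. (c k)\<^sup>2)"
proof -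
  let ?w = "\<lambda>m. cis (2 * pi * real m / real N)"
  let ?P = "\<lambda>m. \<Sum>k\<le>n. of_real (c k) * ?w m ^ k"
  have inner: "(\<Sum>m<N. cis (2 * pi * real m * (real k - real l) / real N))
      = (if k = l then of_nat N else 0)" if "k \<le> n" "l \<le> n" for k l
    using sum_cis_multiples_eq_0[of k N l] that assms by auto
  have "complex_of_real (\<Sum>m<N. (cmod (?P m))\<^sup>2) = (\<Sum>m<N. ?P m * cnj (?P m))"
    by (simp only: complex_norm_square of_real_sum)
  also have "\<dots> = (\<Sum>m<N. \<Sum>k\<le>n. \<Sum>l\<le>n. of_real (c k * c l) *
      cis (2 * pi * real m * (real k - real l) / real N))"
  proof (intro sum.cong refl)
    fix m
    have "?w m ^ k * cnj (?w m ^ l) = cis (2 * pi * real m * (real k - real l) / real N)" for k l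
      by (simp add: Complex.DeMoivre cis_cnj cis_mult algebra_simps diff_divide_distrib)
    then have "of_real (c k) * ?w m ^ k * cnj (of_real (c l) * ?w m ^ l)
        = of_real (c k * c l) * cis (2 * pi * real m * (real k - real l) / real N)" for k l
      by (simp only: complex_cnj_mult complex_cnj_complex_of_real of_real_mult mult_ac)
    then show "?P m * cnj (?P m) = (\<Sum>k\<le>n. \<Sum>l\<le>n. of_real (c k * c l) *
      cis (2 * pi * real m * (real k - real l) / real N))"
      unfolding cnj_sum sum_product
      by (intro sum.cong refl)
  qed
  also have "\<dots> = (\<Sum>k\<le>n. \<Sum>l\<le>n. of_real (c k * c l) *
      (\<Sum>m<N. cis (2 * pi * real m * (real k - real l) / real N)))"
    unfolding sum_distrib_left
    by (subst sum.swap, rule sum.cong[OF refl], rule sum.swap)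
  also have "\<dots> = (\<Sum>k\<le>n. \<Sum>l\<le>n. if k = l then of_real (c k * c l) * of_nat N else 0)"
    by (intro sum.cong refl) (simp add: inner)
  also have "\<dots> = of_real (real N * (\<Sum>k\<le>n. (c k)\<^sup>2))"
    by (simp add: sum_distrib_left power2_eq_square mult_ac)
  finally show ?thesis by (simp only: of_real_eq_iff)
qed

lemma prod_le_arith_mean_power:
  fixes y :: "'a \<Rightarrow> real"
  assumes "finite S" "S \<noteq> {}" "\<And>j. j \<in> S \<Longrightarrow> 0 \<le> y j"
  shows "(\<Prod>j\<in>S. y j) \<le> ((\<Sum>j\<in>S. y j) / real (card S)) ^ card S"
proof -
  have pos: "card S > 0" using assms by (simp add: card_gt_0_iff)
  have mean_nonneg: "0 \<le> (\<Sum>j\<in>S. y j) / real (card S)"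
    using assms by (simp add: sum_nonneg)
  show ?thesis
  proof (cases "(\<Prod>j\<in>S. y j) = 0")
    case True
    then show ?thesis using mean_nonneg by simp
  next
    case False
    then have P: "0 < (\<Prod>j\<in>S. y j)" using assms(3) by (simp add: prod_nonneg less_le)
    have "(\<Prod>j\<in>S. y j) powr (1 / real (card S)) \<le> (\<Sum>j\<in>S. y j) / real (card S)"
      using arith_geom_mean[of S y] assms by (simp add: sum_divide_distrib)
    then have "((\<Prod>j\<in>S. y j) powr (1 / real (card S))) ^ card S
        \<le> ((\<Sum>j\<in>S. y j) / real (card S)) ^ card S"
      by (intro power_mono) simp_all
    then show ?thesis
      using P pos by (simp add: powr_powr flip: powr_realpow)
  qed
qed

text \<open>
  At a point \<open>w = cis \<theta>\<close> of the circle, \<open>\<bar>a j + b j * w\<bar>\<^sup>2 = a j\<^sup>2 + b j\<^sup>2 + 2 cos \<theta> (a j * b j)\<close>.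
  Orthogonality of \<open>a\<close> and \<open>b\<close> makes the sum of these over \<open>j\<close> independent of \<open>\<theta>\<close>, so the inequality of
  arithmetic and geometric means bounds \<open>\<bar>\<Prod>j. a j + b j * w\<bar>\<^sup>2\<close> by the same constant everywhere on
  the circle, and Parseval's identity turns this into a bound on the coefficients.
\<close>
lemma sum_linear_prod_coeff_squares_le:
  fixes a b :: "'a \<Rightarrow> real"
  assumes S: "finite S" "S \<noteq> {}" and orth: "(\<Sum>j\<in>S. a j * b j) = 0"
  shows "(\<Sum>k\<le>card S. (linear_prod_coeff a b S k)\<^sup>2)
    \<le> (((\<Sum>j\<in>S. (a j)\<^sup>2) + (\<Sum>j\<in>S. (b j)\<^sup>2)) / real (card S)) ^ card S" (is "_ \<le> ?M ^ ?n")
proof -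
  define N where "N = Suc ?n"
  define w where "w = (\<lambda>m. cis (2 * pi * real m / real N))"
  have of_real_pc: "complex_of_real (linear_prod_coeff a b S k)
      = linear_prod_coeff (\<lambda>j. of_real (a j)) (\<lambda>j. of_real (b j)) S k" for k
    by (simp add: linear_prod_coeff_def)
  have bound: "(cmod (\<Sum>k\<le>?n. of_real (linear_prod_coeff a b S k) * w m ^ k))\<^sup>2 \<le> ?M ^ ?n" for m
  proof -
    let ?y = "\<lambda>j. (cmod (of_real (a j) + of_real (b j) * w m))\<^sup>2"
    define \<theta> where "\<theta> = 2 * pi * real m / real N"
    have y: "?y j = (a j)\<^sup>2 + (b j)\<^sup>2 + 2 * cos \<theta> * (a j * b j)" for j
    proof -
      have "?y j = (a j)\<^sup>2 + 2 * cos \<theta> * (a j * b j) + (b j)\<^sup>2 * ((cos \<theta>)\<^sup>2 + (sin \<theta>)\<^sup>2)"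
        unfolding w_def \<theta>_def[symmetric]
        unfolding cmod_power2
        by (simp add: power2_sum power_mult_distrib algebra_simps
            del: sin_cos_squared_add sin_cos_squared_add2)
      also have "(cos \<theta>)\<^sup>2 + (sin \<theta>)\<^sup>2 = 1" by simp
      finally show ?thesis by simp
    qed
    have "(cmod (\<Sum>k\<le>?n. of_real (linear_prod_coeff a b S k) * w m ^ k))\<^sup>2 = (\<Prod>j\<in>S. ?y j)"
      unfolding of_real_pc linear_prod_eq_sum_coeff[OF S(1), symmetric]
      by (simp add: prod_norm[symmetric] prod_power_distrib)
    also have "\<dots> \<le> ((\<Sum>j\<in>S. ?y j) / real ?n) ^ ?n"
      using S by (intro prod_le_arith_mean_power) auto
    also have "(\<Sum>j\<in>S. ?y j) = (\<Sum>j\<in>S. (a j)\<^sup>2) + (\<Sum>j\<in>S. (b j)\<^sup>2)"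
      using orth by (simp add: y sum.distrib sum_distrib_left[symmetric])
    finally show ?thesis .
  qed
  have "real N * (\<Sum>k\<le>?n. (linear_prod_coeff a b S k)\<^sup>2)
      = (\<Sum>m<N. (cmod (\<Sum>k\<le>?n. of_real (linear_prod_coeff a b S k) * w m ^ k))\<^sup>2)"
    unfolding w_def by (rule Parseval_roots_of_unity[symmetric]) (simp add: N_def)
  also have "\<dots> \<le> (\<Sum>m<N. ?M ^ ?n)"
    by (intro sum_mono bound)
  also have "\<dots> = real N * ?M ^ ?n" by simp
  finally show ?thesis by (simp add: N_def)
qed

section \<open>Weighted sums of squared elementary symmetric functions\<close>

lemma has_integral_Bernstein:
  assumes "k \<le> n"
  shows "((\<lambda>t. t ^ k * (1 - t) ^ (n - k)) has_integral 1 / (real (Suc n) * real (n choose k))) {0..1::real}"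
proof -
  have "((\<lambda>t. t powr (real (Suc k) - 1) * (1 - t) powr (real (Suc (n - k)) - 1))
      has_integral Beta (real (Suc k)) (real (Suc (n - k)))) {0..1}"
    by (rule has_integral_Beta_real) simp_all
  moreover have "Beta (real (Suc k)) (real (Suc (n - k))) = 1 / (real (Suc n) * real (n choose k))"
  proof -
    have "Beta (real (Suc k)) (real (Suc (n - k))) = fact k * fact (n - k) / fact (Suc n)"
    proof -
      have Gamma_Suc: "Gamma (real (Suc m)) = fact m" for m
        unfolding of_nat_Suc by (rule Gamma_fact)
      have "real (Suc k) + real (Suc (n - k)) = real (Suc (Suc n))"
        using assms by simp
      then show ?thesis by (simp only: Beta_def Gamma_Suc)
    qed
    then show ?thesis
      using assms by (simp add: binomial_fact)
  qed
  ultimately have *: "((\<lambda>t. t powr (real (Suc k) - 1) * (1 - t) powr (real (Suc (n - k)) - 1))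
      has_integral 1 / (real (Suc n) * real (n choose k))) {0..1}" by simp
  \<comment> \<open>The endpoints are excluded because \<open>0 powr 0 = 0\<close> while \<open>0 ^ 0 = 1\<close>.\<close>
  show ?thesis
    by (rule has_integral_spike_finite[OF _ _ *, of "{0, 1}"]) (auto simp: powr_realpow)
qed

text \<open>
  The bound \<open>sum_linear_prod_coeff_squares_le\<close> with \<open>a = sqrt (1 - t)\<close> and \<open>b = sqrt (s t) x\<close> compares the \<open>e\<^sub>k\<^sup>2 s\<^sup>k\<close>, weighted by
  \<open>t\<^sup>k (1 - t)\<^sup>n\<^sup>-\<^sup>k\<close>, with \<open>(1 - t + s D t)\<^sup>n\<close>; expanded binomially, this is the sum of the
  \<open>(n choose k) (s D)\<^sup>k\<close> with the same weights. Integration over \<open>t\<close> replaces each weight by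
  \<open>1 / ((n + 1) (n choose k))\<close>, which cancels the binomial coefficient on the right-hand side and
  produces the one required on the left.
\<close>
theorem sum_elementary_symmetric_squares_le:
  fixes x :: "'a \<Rightarrow> real"
  assumes S: "finite S" "S \<noteq> {}" and mean: "(\<Sum>j\<in>S. x j) = 0" and s: "0 \<le> s"
  defines "D \<equiv> (\<Sum>j\<in>S. (x j)\<^sup>2) / real (card S)"
  shows "(\<Sum>k\<le>card S. (linear_prod_coeff (\<lambda>_. 1) x S k)\<^sup>2 / real (card S choose k) * s ^ k)
    \<le> (\<Sum>k\<le>card S. (s * D) ^ k)"
proof -
  let ?n = "card S" and ?e = "linear_prod_coeff (\<lambda>_. 1) x S"
  have pos: "?n > 0" using S by (simp add: card_gt_0_iff)
  have pointwise: "(\<Sum>k\<le>?n. (?e k)\<^sup>2 * s ^ k * (t ^ k * (1 - t) ^ (?n - k)))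
      \<le> (\<Sum>k\<le>?n. real (?n choose k) * (s * D) ^ k * (t ^ k * (1 - t) ^ (?n - k)))"
    if t: "t \<in> {0..1}" for t
  proof -
    have "(\<Sum>k\<le>?n. (?e k)\<^sup>2 * s ^ k * (t ^ k * (1 - t) ^ (?n - k)))
        = (\<Sum>k\<le>?n. (linear_prod_coeff (\<lambda>j. sqrt (1 - t) * 1) (\<lambda>j. sqrt (s * t) * x j) S k)\<^sup>2)"
    proof (intro sum.cong refl)
      fix k
      have "(sqrt (1 - t) ^ (?n - k))\<^sup>2 = (1 - t) ^ (?n - k)" "(sqrt (s * t) ^ k)\<^sup>2 = (s * t) ^ k"
        using t s by (simp_all flip: real_sqrt_power)
      then show "(?e k)\<^sup>2 * s ^ k * (t ^ k * (1 - t) ^ (?n - k))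
          = (linear_prod_coeff (\<lambda>j. sqrt (1 - t) * 1) (\<lambda>j. sqrt (s * t) * x j) S k)\<^sup>2"
        unfolding linear_prod_coeff_scale[OF S(1)] power_mult_distrib by (simp add: mult_ac)
    qed
    also have "\<dots> \<le> (((\<Sum>j\<in>S. (sqrt (1 - t) * 1)\<^sup>2) + (\<Sum>j\<in>S. (sqrt (s * t) * x j)\<^sup>2)) / real ?n) ^ ?n"
      using mean by (intro sum_linear_prod_coeff_squares_le S) (simp add: mult.assoc flip: sum_distrib_left)
    also have "((\<Sum>j\<in>S. (sqrt (1 - t) * 1)\<^sup>2) + (\<Sum>j\<in>S. (sqrt (s * t) * x j)\<^sup>2)) / real ?n
        = s * D * t + (1 - t)"
      using t s pos by (simp add: D_def power_mult_distrib field_simps flip: sum_distrib_left)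
    also have "(s * D * t + (1 - t)) ^ ?n
        = (\<Sum>k\<le>?n. real (?n choose k) * (s * D) ^ k * (t ^ k * (1 - t) ^ (?n - k)))"
      by (simp add: binomial_ring power_mult_distrib mult_ac)
    finally show ?thesis .
  qed
  have "(\<Sum>k\<le>?n. (?e k)\<^sup>2 * s ^ k * (1 / (real (Suc ?n) * real (?n choose k))))
      \<le> (\<Sum>k\<le>?n. real (?n choose k) * (s * D) ^ k * (1 / (real (Suc ?n) * real (?n choose k))))"
  proof (rule has_integral_le)
    show "((\<lambda>t. \<Sum>k\<le>?n. (?e k)\<^sup>2 * s ^ k * (t ^ k * (1 - t) ^ (?n - k))) has_integral
      (\<Sum>k\<le>?n. (?e k)\<^sup>2 * s ^ k * (1 / (real (Suc ?n) * real (?n choose k))))) {0..1}"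
      by (intro has_integral_sum has_integral_mult_right has_integral_Bernstein) auto
    show "((\<lambda>t. \<Sum>k\<le>?n. real (?n choose k) * (s * D) ^ k * (t ^ k * (1 - t) ^ (?n - k))) has_integral
      (\<Sum>k\<le>?n. real (?n choose k) * (s * D) ^ k * (1 / (real (Suc ?n) * real (?n choose k))))) {0..1}"
      by (intro has_integral_sum has_integral_mult_right has_integral_Bernstein) auto
  qed (rule pointwise)
  moreover have "(\<Sum>k\<le>?n. (?e k)\<^sup>2 * s ^ k * (1 / (real (Suc ?n) * real (?n choose k))))
      = (\<Sum>k\<le>?n. (?e k)\<^sup>2 / real (?n choose k) * s ^ k) / real (Suc ?n)"
    by (simp add: sum_divide_distrib mult_ac)
  moreover have "(\<Sum>k\<le>?n. real (?n choose k) * (s * D) ^ k * (1 / (real (Suc ?n) * real (?n choose k))))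
      = (\<Sum>k\<le>?n. (s * D) ^ k) / real (Suc ?n)"
    unfolding sum_divide_distrib by (intro sum.cong refl) (simp add: binomial_eq_0_iff not_less)
  ultimately show ?thesis
    by (simp add: divide_le_cancel)
qed

text \<open>
  The factor \<open>D ^ 3\<close> comes from the freedom in \<open>s\<close>: enlarging \<open>s\<close> beyond \<open>1\<close> multiplies the terms with
  \<open>k \<ge> 3\<close> by at least \<open>s ^ 3\<close>, while the bound \<open>\<Sum>k. (s * D) ^ k\<close> of
  \<open>sum_elementary_symmetric_squares_le\<close> is at most \<open>1 / (1 - s * D)\<close> as long as \<open>s * D < 1\<close>.
\<close>
lemma sum_elementary_symmetric_squares_tail_le:
  fixes x :: "'a \<Rightarrow> real"
  assumes S: "finite S" "S \<noteq> {}" and mean: "(\<Sum>j\<in>S. x j) = 0"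
  defines "D \<equiv> (\<Sum>j\<in>S. (x j)\<^sup>2) / real (card S)"
  assumes D: "D < 1"
  shows "(\<Sum>k=3..card S. (linear_prod_coeff (\<lambda>_. 1) x S k)\<^sup>2 / real (card S choose k)) \<le> 16 * D ^ 3 / (1 - D)"
proof -
  let ?A = "\<lambda>k. (linear_prod_coeff (\<lambda>_. 1) x S k)\<^sup>2 / real (card S choose k)"
  have A_nonneg: "0 \<le> ?A k" for k by simp
  have "0 \<le> D" by (simp add: D_def sum_nonneg)
  have scaled: "s ^ 3 * (\<Sum>k=3..card S. ?A k) \<le> (\<Sum>k\<le>card S. (s * D) ^ k) - 1" if s: "1 \<le> s" for s
  proof -
    have "s ^ 3 * (\<Sum>k=3..card S. ?A k) \<le> (\<Sum>k=3..card S. ?A k * s ^ k)"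
      unfolding sum_distrib_left
    proof (intro sum_mono)
      fix k assume "k \<in> {3..card S}"
      then have "s ^ 3 \<le> s ^ k" using s by (intro power_increasing) auto
      then show "s ^ 3 * ?A k \<le> ?A k * s ^ k"
        using mult_left_mono[OF _ A_nonneg[of k]] by (simp only: mult.commute)
    qed
    also have "\<dots> \<le> (\<Sum>k\<in>{..card S} - {0}. ?A k * s ^ k)"
      using s by (intro sum_mono2) auto
    also have "\<dots> = (\<Sum>k\<le>card S. ?A k * s ^ k) - 1"
      using S by (subst sum_diff1) (auto simp: linear_prod_coeff_0)
    also have "\<dots> \<le> (\<Sum>k\<le>card S. (s * D) ^ k) - 1"
      unfolding D_def using s by (intro diff_right_mono sum_elementary_symmetric_squares_le S mean) auto
    finally show ?thesis .
  qed
  show ?thesis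
  proof (cases "D = 0")
    case True
    \<comment> \<open>Only \<open>0 ^ 0 = 1\<close> survives in the geometric sum, so the tail vanishes.\<close>
    have "(\<Sum>k\<le>card S. (1 * D) ^ k) = 1" by (simp add: True power_0_left)
    then show ?thesis using scaled[of 1] True by simp
  next
    case False
    then have D0: "0 < D" using \<open>0 \<le> D\<close> by simp
    \<comment> \<open>This choice puts \<open>s * D\<close> halfway between \<open>D\<close> and \<open>1\<close>.\<close>
    define s where "s = (1 + D) / (2 * D)"
    have s1: "1 \<le> s" using D0 D by (simp add: s_def field_simps)
    have sD: "s * D = (1 + D) / 2" using D0 by (simp add: s_def)
    have "(1 / (2 * D)) ^ 3 * (\<Sum>k=3..card S. ?A k) \<le> s ^ 3 * (\<Sum>k=3..card S. ?A k)"
      using D0 by (intro mult_right_mono power_mono sum_nonneg A_nonneg) (auto simp: s_def field_simps)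
    also have "\<dots> \<le> (\<Sum>k\<le>card S. (s * D) ^ k)"
      using scaled[OF s1] by simp
    also have "\<dots> \<le> 1 / (1 - s * D)"
    proof -
      have "(\<Sum>k\<le>card S. (s * D) ^ k) = (1 - (s * D) ^ Suc (card S)) / (1 - s * D)"
        using D D0 by (subst sum_gp0) (simp add: sD)
      also have "\<dots> \<le> 1 / (1 - s * D)"
        using D D0 by (intro divide_right_mono) (simp_all add: sD)
      finally show ?thesis .
    qed
    also have "1 - s * D = (1 - D) / 2" unfolding sD by (simp add: field_simps)
    finally have "(1 / (2 * D)) ^ 3 * (\<Sum>k=3..card S. ?A k) \<le> 2 / (1 - D)" by simp
    then have "(2 * D) ^ 3 * ((1 / (2 * D)) ^ 3 * (\<Sum>k=3..card S. ?A k)) \<le> (2 * D) ^ 3 * (2 / (1 - D))"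
      using D0 by (intro mult_left_mono) auto
    moreover have "(2 * D) ^ 3 * (1 / (2 * D)) ^ 3 = 1"
      unfolding power_mult_distrib[symmetric] using D0 by simp
    ultimately show ?thesis by (simp add: power_mult_distrib flip: mult.assoc)
  qed
qed

section \<open>Expansion of the chi-squared distance\<close>

lemma pmf_indicator_sum_law:
  assumes p: "\<And>j. j \<in> {1..n} \<Longrightarrow> p j \<in> {0..1}"
  shows "pmf (indicator_sum_law n p) k = linear_prod_coeff (\<lambda>j. 1 - p j) p {1..n} k"
proof -
  define S where "S = {1..n}"
  define D where "D = Pi_pmf S False (\<lambda>j. bernoulli_pmf (p j))"
  define f :: "(nat \<Rightarrow> bool) \<Rightarrow> nat" where "f = (\<lambda>I. \<Sum>j\<in>S. of_bool (I j))"
  let ?ind = "\<lambda>A j. j \<in> (A :: nat set)"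
  let ?F = "{A. A \<subseteq> S \<and> card A = k}"
  have S: "finite S" by (simp add: S_def)
  have f_eq: "f I = card {j\<in>S. I j}" for I
    using S by (simp add: f_def of_bool_def sum.If_cases Int_def)
  have "pmf (indicator_sum_law n p) k = measure_pmf.prob D (f -` {k})"
    by (simp add: indicator_sum_law_def pmf_map D_def f_def S_def)
  also have "\<dots> = measure_pmf.prob D (?ind ` ?F)"
  proof (intro measure_pmf.finite_measure_eq_AE)
    show "AE I in measure_pmf D. I \<in> f -` {k} \<longleftrightarrow> I \<in> ?ind ` ?F"
    proof (rule AE_pmfI)
      fix I assume "I \<in> set_pmf D"
      then have I: "I j \<Longrightarrow> j \<in> S" for j
        using set_Pi_pmf_subset[OF S, of False "\<lambda>j. bernoulli_pmf (p j)"] by (auto simp: D_def)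
      have "I = ?ind {j\<in>S. I j}" using I by auto
      then show "I \<in> f -` {k} \<longleftrightarrow> I \<in> ?ind ` ?F"
        by (auto simp: f_eq intro!: image_eqI[of _ _ "{j\<in>S. I j}"] intro: arg_cong[where f = card])
    qed
  qed simp_all
  also have "\<dots> = (\<Sum>A\<in>?F. pmf D (?ind A))"
  proof -
    have "inj_on ?ind ?F" by (auto simp: inj_on_def fun_eq_iff)
    then show ?thesis
      using S by (subst measure_measure_pmf_finite) (simp_all add: sum.reindex)
  qed
  also have "\<dots> = linear_prod_coeff (\<lambda>j. 1 - p j) p S k"
    unfolding linear_prod_coeff_def
  proof (intro sum.cong refl)
    fix A assume A: "A \<in> ?F"
    have "pmf D (?ind A) = (\<Prod>j\<in>S. if j \<in> A then p j else 1 - p j)"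
      unfolding D_def using A S p by (subst pmf_Pi') (auto simp: S_def intro!: prod.cong)
    also have "\<dots> = (\<Prod>j\<in>A. p j) * (\<Prod>j\<in>S - A. 1 - p j)"
      using A S by (simp add: prod.If_cases Int_absorb1 Diff_eq Int_absorb2 Int_commute)
    finally show "pmf D (?ind A) = (\<Prod>j\<in>A. p j) * (\<Prod>j\<in>S - A. 1 - p j)" .
  qed
  finally show ?thesis by (simp add: S_def)
qed

text \<open>
  With \<open>P\<close> the law of the sum and \<open>B\<close> the binomial law, expanding the square gives
  \<open>1 + \<chi>\<^sup>2 = \<Sum>k. P(k)\<^sup>2 / B(k)\<close>. The factor \<open>pb\<^sup>k q\<^sup>n\<^sup>-\<^sup>k\<close> in \<open>B(k)\<close> is absorbed by rescaling the linear factors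
  to \<open>(1 - p j) / sqrt q\<close> and \<open>p j / sqrt pb\<close>, which leaves the weight \<open>1 / (n choose k)\<close> of the permanent
  identity. The rescaled vectors have inner products \<open>1 + x i * x j\<close>, the same as the vectors \<open>(1, x j)\<close>.
\<close>
lemma chi2_dist_eq_sum_elementary_symmetric:
  fixes p :: "nat \<Rightarrow> real"
  assumes p: "\<And>j. j \<in> {1..n} \<Longrightarrow> p j \<in> {0..1}" and n: "n > 0"
    and pb: "0 < pb" "pb < 1" and mean: "(\<Sum>j=1..n. p j) = real n * pb"
  defines "x \<equiv> (\<lambda>j. (p j - pb) / sqrt (pb * (1 - pb)))"
  shows "1 + chi2_dist n (indicator_sum_law n p) (binomial_pmf n pb)
    = (\<Sum>k\<le>n. (linear_prod_coeff (\<lambda>_. 1) x {1..n} k)\<^sup>2 / real (n choose k))"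
proof -
  define q where "q = 1 - pb"
  have q: "0 < q" using pb by (simp add: q_def)
  let ?S = "{1..n}"
  let ?P = "linear_prod_coeff (\<lambda>j. 1 - p j) p ?S"
  define a where "a = (\<lambda>j. 1 / sqrt q * (1 - p j))"
  define b where "b = (\<lambda>j. 1 / sqrt pb * p j)"
  have bin: "pmf (binomial_pmf n pb) k = real (n choose k) * pb ^ k * q ^ (n - k)" for k
    using pb by (simp add: q_def)
  have P_sum: "(\<Sum>k\<le>n. ?P k) = 1"
    using linear_prod_eq_sum_coeff[of ?S "\<lambda>j. 1 - p j" p 1] by simp
  have bin_sum: "(\<Sum>k\<le>n. pmf (binomial_pmf n pb) k) = 1"
    using binomial_ring[of pb q n] by (simp add: bin) (simp add: q_def)
  have summand: "\<bar>?P k / pmf (binomial_pmf n pb) k - 1\<bar> ^ 2 * pmf (binomial_pmf n pb) k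
      = (linear_prod_coeff a b ?S k)\<^sup>2 / real (n choose k) - 2 * ?P k + pmf (binomial_pmf n pb) k"
    if k: "k \<le> n" for k
  proof -
    let ?B = "pmf (binomial_pmf n pb) k"
    have B: "?B \<noteq> 0" using k pb q by (simp add: bin del: pmf_binomial)
    have "(linear_prod_coeff a b ?S k)\<^sup>2 = (?P k)\<^sup>2 / (q ^ (n - k) * pb ^ k)"
    proof -
      have "(linear_prod_coeff a b ?S k)\<^sup>2 = ((1 / sqrt q)\<^sup>2) ^ (n - k) * ((1 / sqrt pb)\<^sup>2) ^ k * (?P k)\<^sup>2"
        unfolding a_def b_def
        unfolding linear_prod_coeff_scale[OF finite_atLeastAtMost] power_mult_distrib
        by (simp only: card_atLeastAtMost power_mult[symmetric] mult.commute[of _ 2] diff_Suc_1)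
      then show ?thesis using pb q by (simp add: power_divide)
    qed
    then have "(linear_prod_coeff a b ?S k)\<^sup>2 / real (n choose k) = (?P k)\<^sup>2 / ?B"
      by (simp add: bin mult_ac del: pmf_binomial)
    then show ?thesis
      using B by (simp add: power2_eq_square field_simps del: pmf_binomial)
  qed
  have gram: "a i * a j + b i * b j = 1 * 1 + x i * x j" for i j
  proof -
    have "x i * x j = (p i - pb) * (p j - pb) / (pb * q)"
      using pb q by (simp add: x_def flip: q_def)
    moreover have "a i * a j + b i * b j = (1 - p i) * (1 - p j) / q + p i * p j / pb"
      using pb q by (simp add: a_def b_def)
    moreover have "(1 - p i) * (1 - p j) / q + p i * p j / pb = 1 + (p i - pb) * (p j - pb) / (pb * q)"
    proof -
      have "(1 - p i) * (1 - p j) * pb + p i * p j * q = pb * q + (p i - pb) * (p j - pb)"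
        by (simp add: q_def algebra_simps)
      then show ?thesis using pb q by (simp add: field_simps)
    qed
    ultimately show ?thesis by simp
  qed
  have "chi2_dist n (indicator_sum_law n p) (binomial_pmf n pb)
      = (\<Sum>k\<le>n. \<bar>?P k / pmf (binomial_pmf n pb) k - 1\<bar> ^ 2 * pmf (binomial_pmf n pb) k)"
    unfolding chi2_dist_def atLeast0AtMost using p by (simp only: pmf_indicator_sum_law)
  also have "\<dots> = (\<Sum>k\<le>n. (linear_prod_coeff a b ?S k)\<^sup>2 / real (n choose k) - 2 * ?P k
      + pmf (binomial_pmf n pb) k)"
    using summand by (intro sum.cong refl) simp
  also have "\<dots> = (\<Sum>k\<le>n. (linear_prod_coeff a b ?S k)\<^sup>2 / real (n choose k)) - 1"
    by (simp only: sum.distrib sum_subtractf sum_distrib_left[symmetric] P_sum bin_sum)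
  also have "(\<Sum>k\<le>n. (linear_prod_coeff a b ?S k)\<^sup>2 / real (n choose k))
      = (\<Sum>k\<le>n. (linear_prod_coeff (\<lambda>_. 1) x ?S k)\<^sup>2 / real (n choose k))"
    using sum_linear_prod_coeff_squares_eq_permanent[of ?S a b]
      sum_linear_prod_coeff_squares_eq_permanent[of ?S "\<lambda>_. 1" x]
    by (simp add: gram)
  finally show ?thesis by simp
qed

section \<open>Bounds for the chi-squared distance\<close>

theorem theorem1p1:
  shows "\<exists>C::real. C > 0 \<and>
    (\<forall>(n::nat) (p::nat \<Rightarrow> real).
       n \<ge> 2 \<longrightarrow>
       (\<forall>j\<in>{1..n}. p j \<in> {0..1}) \<longrightarrow>
       \<not> ((\<forall>j\<in>{1..n}. p j = 0) \<or> (\<forall>j\<in>{1..n}. p j = 1)) \<longrightarrow>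
       delta_m n p 2 < 1 \<longrightarrow>
       (let \<delta> = delta_m n p 2;
            \<delta>\<^sub>3 = delta_m n p 3;
            X2 = chi2_dist n (indicator_sum_law n p) (binomial_pmf n (mean_p n p))
        in real n / (2 * (real n - 1)) * \<delta>\<^sup>2 \<le> X2 \<and>
           X2 \<le> real n / (2 * (real n - 1)) * \<delta>\<^sup>2 *
             (1 + C * (\<delta> / (1 - \<delta>) + 1 / sqrt (real n) * (if \<delta> = 0 then 0 else \<delta>\<^sub>3 / \<delta>)))))"
  \<comment> \<open>\<open>32 = 2 * 16\<close>, because the term \<open>k = 2\<close> is at least \<open>\<delta>\<^sup>2 / 2\<close>.\<close>
proof (intro exI[of _ 32] conjI allI impI)
  fix n :: nat and p :: "nat \<Rightarrow> real"
  assume n: "n \<ge> 2" and p: "\<forall>j\<in>{1..n}. p j \<in> {0..1}"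
    and nontrivial: "\<not> ((\<forall>j\<in>{1..n}. p j = 0) \<or> (\<forall>j\<in>{1..n}. p j = 1))"
    and delta: "delta_m n p 2 < 1"
  define pb where "pb = mean_p n p"
  define \<delta> where "\<delta> = delta_m n p 2"
  define \<delta>\<^sub>3 where "\<delta>\<^sub>3 = delta_m n p 3"
  define X2 where "X2 = chi2_dist n (indicator_sum_law n p) (binomial_pmf n pb)"
  define x where "x = (\<lambda>j. (p j - pb) / sqrt (pb * (1 - pb)))"
  let ?A = "\<lambda>k. (linear_prod_coeff (\<lambda>_. 1) x {1..n} k)\<^sup>2 / real (n choose k)"
  have mean: "(\<Sum>j=1..n. p j) = real n * pb" using n by (simp add: pb_def mean_p_def)
  have "0 < pb"
  proof -
    obtain j where "j \<in> {1..n}" "p j \<noteq> 0" using nontrivial by blast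
    then have "0 < (\<Sum>j=1..n. p j)"
      using p by (intro sum_pos2[of _ j]) (auto simp: less_le)
    then show ?thesis using n unfolding mean by (simp add: zero_less_mult_iff)
  qed
  have "pb < 1"
  proof -
    obtain j where "j \<in> {1..n}" "p j \<noteq> 1" using nontrivial by blast
    then have "0 < (\<Sum>j=1..n. 1 - p j)"
      using p by (intro sum_pos2[of _ j]) (auto simp: less_le)
    then have "real n * pb < real n * 1" unfolding sum_subtractf mean by simp
    then show ?thesis using n by (subst (asm) mult_less_cancel_left_pos) auto
  qed
  note pb = \<open>0 < pb\<close> \<open>pb < 1\<close>
  have pq: "0 < pb * (1 - pb)" using pb by simp
  have x_sum: "(\<Sum>j=1..n. x j) = 0"
  proof -
    have "(\<Sum>j=1..n. x j) = ((\<Sum>j=1..n. p j) - real n * pb) / sqrt (pb * (1 - pb))"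
      by (simp add: x_def sum_subtractf flip: sum_divide_distrib)
    then show ?thesis unfolding mean by simp
  qed
  have x_sq: "(\<Sum>j=1..n. (x j)\<^sup>2) = real n * \<delta>"
    using n pq
    by (simp add: x_def \<delta>_def delta_m_def Let_def power_divide flip: pb_def sum_divide_distrib)
  then have \<delta>_eq: "\<delta> = (\<Sum>j\<in>{1..n}. (x j)\<^sup>2) / real (card {1..n})" using n by simp
  have \<delta>: "0 \<le> \<delta>" "\<delta> < 1" using delta by (simp_all add: \<delta>_eq sum_nonneg flip: \<delta>_def)
  have \<delta>\<^sub>3: "0 \<le> \<delta>\<^sub>3" by (simp add: \<delta>\<^sub>3_def delta_m_def Let_def sum_nonneg)
  have A0: "?A 0 = 1" by (simp add: linear_prod_coeff_0)
  have A1: "?A 1 = 0" using linear_prod_coeff_1[of "{1..n}" x] x_sum by simp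
  have A2: "?A 2 = real n / (2 * (real n - 1)) * \<delta>\<^sup>2"
  proof -
    have e2: "linear_prod_coeff (\<lambda>_. 1) x {1..n} 2 = - real n * \<delta> / 2"
      using linear_prod_coeff_2[of "{1..n}" x] x_sum x_sq by simp
    have c2: "real (n choose 2) = real n * (real n - 1) / 2"
    proof -
      have "2 * (n choose 2) = n * (n - 1)"
        unfolding choose_two by (intro dvd_mult_div_cancel) (cases n, auto)
      then have "2 * real (n choose 2) = real n * real (n - 1)" by (metis of_nat_mult of_nat_numeral)
      then show ?thesis using n by (simp add: of_nat_diff)
    qed
    have "real n - 1 \<noteq> 0" "real n \<noteq> 0" using n by auto
    then show ?thesis unfolding e2 c2 by (simp add: power2_eq_square divide_simps)
  qed
  have "1 + X2 = (\<Sum>k\<le>n. ?A k)"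
    unfolding X2_def x_def using p n pb mean by (intro chi2_dist_eq_sum_elementary_symmetric) auto
  also have "{..n} = {0, 1, 2} \<union> {3..n}" using n by auto
  also have "(\<Sum>k\<in>{0, 1, 2} \<union> {3..n}. ?A k) = (\<Sum>k\<in>{0, 1, 2}. ?A k) + (\<Sum>k=3..n. ?A k)"
    by (intro sum.union_disjoint) auto
  also have "(\<Sum>k\<in>{0, 1, 2}. ?A k) = ?A 0 + ?A 1 + ?A 2" by simp
  finally have X2: "X2 = ?A 2 + (\<Sum>k=3..n. ?A k)" using A0 A1 by linarith
  have lower: "?A 2 \<le> X2" unfolding X2 by (simp add: sum_nonneg)
  have "(\<Sum>k=3..n. ?A k) \<le> 16 * \<delta> ^ 3 / (1 - \<delta>)"
    using sum_elementary_symmetric_squares_tail_le[of "{1..n}" x, folded \<delta>_eq] n x_sum \<delta>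
    by simp
  also have "\<dots> = 1 / 2 * \<delta>\<^sup>2 * (32 * (\<delta> / (1 - \<delta>)))"
    by (simp add: power2_eq_square power3_eq_cube)
  also have "\<dots> \<le> ?A 2 * (32 * (\<delta> / (1 - \<delta>) + 1 / sqrt (real n) * (if \<delta> = 0 then 0 else \<delta>\<^sub>3 / \<delta>)))"
  proof (intro mult_mono)
    have "1 / 2 \<le> real n / (2 * (real n - 1))" using n by (simp add: field_simps)
    then show "1 / 2 * \<delta>\<^sup>2 \<le> ?A 2" unfolding A2 by (intro mult_right_mono) auto
  qed (use \<delta> \<delta>\<^sub>3 in auto)
  finally have "X2 \<le> ?A 2 * (1 + 32 * (\<delta> / (1 - \<delta>) + 1 / sqrt (real n) * (if \<delta> = 0 then 0 else \<delta>\<^sub>3 / \<delta>)))"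
    unfolding X2 by (simp only: distrib_left mult_1_right)
  then show "let \<delta> = delta_m n p 2;
            \<delta>\<^sub>3 = delta_m n p 3;
            X2 = chi2_dist n (indicator_sum_law n p) (binomial_pmf n (mean_p n p))
        in real n / (2 * (real n - 1)) * \<delta>\<^sup>2 \<le> X2 \<and>
           X2 \<le> real n / (2 * (real n - 1)) * \<delta>\<^sup>2 *
             (1 + 32 * (\<delta> / (1 - \<delta>) + 1 / sqrt (real n) * (if \<delta> = 0 then 0 else \<delta>\<^sub>3 / \<delta>)))"
    using lower unfolding A2 Let_def X2_def pb_def \<delta>_def \<delta>\<^sub>3_def by blast
qed simp

end
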